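(* Let $\Omega\subset\mathbb{R}^N$ be a bounded domain with $\mathcal{C}^2$-boundary, let $p>1$, and let $g=(g_1,\dots,g_N)\in\mathcal{C}^1(\mathbb{R},\mathbb{R}^N)$. Let $\sigma\in\mathcal{C}^1_b(\partial\Omega\times(0,\infty))$ with $\sigma\ge 0$ on $\partial\Omega\times(0,\infty)$, and suppose there exists $\delta>0$ such that $$\inf_{x\in\partial\Omega}\sigma(x,t)\ \ge\ \delta\,\sup_{x\in\partial\Omega}\sigma(x,t)\quad\text{for all } t>0,\qquad\text{and}\qquad \Big(\sup_{x\in\partial\Omega}\sigma(x,\cdot)\Big)^{-1}\in L^1_{\mathrm{loc}}([0,\infty)).$$ Let $u_0\in\mathcal{C}(\overline\Omega)$ with $u_0\ge 0$ and $u_0\not\equiv 0$. If there exists an integer $1\le j\le N$ such that $$\liminf_{\omega\to\infty}\frac{g_j(\omega)}{\omega^{p-1}}>0,$$ then the maximal classical solution of $$\begin{cases}\partial_t u=\Delta u-g(u)\cdot\nabla u+u^p & \text{in }\overline\Omega\text{ for }t>0,\\ \sigma\,\partial_t u+\partial_\nu u=0 & \text{on }\partial\Omega\text{ for }t>0,\\ u(\cdot,0)=u_0 & \text{in }\overline\Omega,\end{cases}$$ is a global solution, i.e. its maximal existence time is $T=\infty$.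
   Context: $\nu$ is the outer unit normal field on $\partial\Omega$ and $\partial_\nu$ the outer normal derivative. $\mathcal{C}^1_b$ denotes $\mathcal{C}^1$ functions that are bounded with bounded first derivatives. The unique maximal classical solution is a nonnegative function $u\in\mathcal{C}(\overline\Omega\times[0,T))\cap\mathcal{C}^{2,1}(\overline\Omega\times(0,T))$, where the maximal existence time $T=T(\sigma,u_0)\in(0,\infty]$ coincides with the blow-up time in the $L^\infty$-norm: $T=\inf\{s>0 : \lim_{t\nearrow s}\sup_{x\in\overline\Omega}|u(x,t)|=\infty\}$ (with $\inf\emptyset=\infty$). *)

theory Defs
  imports "HOL-Analysis.Analysis"
begin

section \<open>Bounded domains with \<open>C\<^sup>2\<close> boundary\<close>

text \<open>
  \<open>\<rho>\<close> is a \<open>C\<^sup>2\<close> function on the open set \<open>U\<close>, with nowhere vanishing gradient \<open>D\<rho>\<close>, and \<open>\<Omega>\<close> is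
  the sublevel set \<open>\<rho> < 0\<close> in \<open>U\<close>. Since \<open>D\<rho>\<close> does not vanish, this forces the boundary of
  \<open>\<Omega>\<close> in \<open>U\<close> to be the level set \<open>\<rho> = 0\<close>, with \<open>\<Omega>\<close> on one side of it only.
\<close>

definition C2_defining_function ::
  "(real^'n) set \<Rightarrow> (real^'n) set \<Rightarrow> (real^'n \<Rightarrow> real) \<Rightarrow> (real^'n \<Rightarrow> real^'n) \<Rightarrow> bool" where
  "C2_defining_function \<Omega> U \<rho> D\<rho> \<longleftrightarrow>
     open U \<and>
     (\<exists>D2\<rho> :: real^'n \<Rightarrow> real^'n^'n.
        continuous_on U D2\<rho> \<and>
        (\<forall>x\<in>U. (\<rho> has_derivative (\<lambda>h. D\<rho> x \<bullet> h)) (at x) \<and>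
               (D\<rho> has_derivative (\<lambda>h. D2\<rho> x *v h)) (at x))) \<and>
     (\<forall>x\<in>U. D\<rho> x \<noteq> 0) \<and>
     \<Omega> \<inter> U = {x\<in>U. \<rho> x < 0}"

definition bounded_C2_domain :: "(real^'n) set \<Rightarrow> bool" where
  "bounded_C2_domain \<Omega> \<longleftrightarrow>
     open \<Omega> \<and> connected \<Omega> \<and> \<Omega> \<noteq> {} \<and> bounded \<Omega> \<and>
     (\<forall>x\<in>frontier \<Omega>. \<exists>U \<rho> D\<rho>. x \<in> U \<and> C2_defining_function \<Omega> U \<rho> D\<rho>)"

text \<open>The normalised gradient at a boundary point does not depend on the defining function.\<close>

definition outer_unit_normal :: "(real^'n) set \<Rightarrow> real^'n \<Rightarrow> real^'n" where
  "outer_unit_normal \<Omega> x =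
     (THE n. \<exists>U \<rho> D\<rho>. x \<in> U \<and> C2_defining_function \<Omega> U \<rho> D\<rho> \<and> n = D\<rho> x /\<^sub>R norm (D\<rho> x))"

section \<open>The coefficient on the boundary\<close>

text \<open>
  \<open>C\<^sup>1\<^sub>b\<close> on a \<open>C\<^sup>1\<close> submanifold \<open>S\<close> of a Euclidean space: the derivative \<open>D z\<close> within \<open>S\<close> is
  determined on the tangent space of \<open>S\<close> at \<open>z\<close> only. A continuous (bounded) family of
  tangential derivatives gives a continuous (bounded) family \<open>D\<close> by composing with the
  orthogonal projection onto the tangent space, so the existence of \<open>D\<close> is the usual notion.
\<close>

definition C1_bounded_on :: "'a::euclidean_space set \<Rightarrow> ('a \<Rightarrow> real) \<Rightarrow> bool" where
  "C1_bounded_on S f \<longleftrightarrow>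
     bounded (f ` S) \<and>
     (\<exists>D :: 'a \<Rightarrow> 'a \<Rightarrow>\<^sub>L real.
        continuous_on S D \<and> bounded (D ` S) \<and>
        (\<forall>z\<in>S. (f has_derivative blinfun_apply (D z)) (at z within S)))"

text \<open>
  Membership in \<open>L\<^sup>1\<^sub>l\<^sub>o\<^sub>c([0,\<infinity>))\<close> of a nonnegative function, given on \<open>(0,\<infinity>)\<close>. Values
  are extended nonnegative reals since the reciprocal of \<open>0\<close> has to be \<open>\<infinity>\<close> and not \<open>0\<close>.
\<close>

definition L1_loc_halfline :: "(real \<Rightarrow> ennreal) \<Rightarrow> bool" where
  "L1_loc_halfline f \<longleftrightarrow>
     (\<lambda>t. f t * indicator {0<..} t) \<in> borel_measurable lebesgue \<and>
     (\<forall>R>0. (\<integral>\<^sup>+t\<in>{0<..R}. f t \<partial>lebesgue) < \<infinity>)"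

section \<open>Classical solutions\<close>

text \<open>
  Space derivatives are taken within \<open>closure \<Omega>\<close>, hence one-sided at boundary points. For a domain
  with \<open>C\<^sup>2\<close> boundary they are unique, and their existence and continuity up to the boundary
  amounts to continuous extendability of the interior derivatives. So \<open>ut\<close>, \<open>Du\<close> and \<open>D2u\<close> are
  the time derivative, the gradient and the Hessian of \<open>u\<close>.
\<close>

definition C21_with_derivatives ::
  "(real^'n) set \<Rightarrow> ereal \<Rightarrow> (real^'n \<Rightarrow> real \<Rightarrow> real) \<Rightarrow> (real^'n \<Rightarrow> real \<Rightarrow> real) \<Rightarrow>
   (real^'n \<Rightarrow> real \<Rightarrow> real^'n) \<Rightarrow> (real^'n \<Rightarrow> real \<Rightarrow> real^'n^'n) \<Rightarrow> bool" where
  "C21_with_derivatives \<Omega> T u ut Du D2u \<longleftrightarrow>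
     (let Q = closure \<Omega> \<times> {t. 0 < t \<and> ereal t < T} in
       continuous_on Q (\<lambda>(x,t). u x t) \<and> continuous_on Q (\<lambda>(x,t). ut x t) \<and>
       continuous_on Q (\<lambda>(x,t). Du x t) \<and> continuous_on Q (\<lambda>(x,t). D2u x t) \<and>
       (\<forall>(x,t)\<in>Q.
          ((\<lambda>s. u x s) has_real_derivative ut x t) (at t) \<and>
          ((\<lambda>y. u y t) has_derivative (\<lambda>h. Du x t \<bullet> h)) (at x within closure \<Omega>) \<and>
          ((\<lambda>y. Du y t) has_derivative (\<lambda>h. D2u x t *v h)) (at x within closure \<Omega>)))"

text \<open>
  Nonnegative classical solutions on \<open>[0,T)\<close>, \<open>0 < T \<le> \<infinity>\<close>. Values of \<open>u\<close> outside
  \<open>closure \<Omega> \<times> [0,T)\<close> are irrelevant.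
\<close>

definition classical_solution ::
  "(real^'n) set \<Rightarrow> real \<Rightarrow> (real \<Rightarrow> real^'n) \<Rightarrow> (real^'n \<Rightarrow> real \<Rightarrow> real) \<Rightarrow> (real^'n \<Rightarrow> real) \<Rightarrow>
   ereal \<Rightarrow> (real^'n \<Rightarrow> real \<Rightarrow> real) \<Rightarrow> bool" where
  "classical_solution \<Omega> p g \<sigma> u0 T u \<longleftrightarrow>
     0 < T \<and>
     continuous_on (closure \<Omega> \<times> {t. 0 \<le> t \<and> ereal t < T}) (\<lambda>(x,t). u x t) \<and>
     (\<forall>x\<in>closure \<Omega>. \<forall>t. 0 \<le> t \<and> ereal t < T \<longrightarrow> 0 \<le> u x t) \<and>
     (\<forall>x\<in>closure \<Omega>. u x 0 = u0 x) \<and>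
     (\<exists>ut Du D2u.
        C21_with_derivatives \<Omega> T u ut Du D2u \<and>
        (\<forall>t. 0 < t \<and> ereal t < T \<longrightarrow>
           (\<forall>x\<in>closure \<Omega>.
              ut x t = trace (D2u x t) - g (u x t) \<bullet> Du x t + u x t powr p) \<and>
           (\<forall>x\<in>frontier \<Omega>.
              \<sigma> x t * ut x t + Du x t \<bullet> outer_unit_normal \<Omega> x = 0)))"

text \<open>The infimum of the empty set is \<open>\<infinity>\<close>. Only times \<open>s \<le> T\<close> make sense for \<open>u\<close> given on \<open>[0,T)\<close>.\<close>

definition blow_up_time :: "(real^'n) set \<Rightarrow> ereal \<Rightarrow> (real^'n \<Rightarrow> real \<Rightarrow> real) \<Rightarrow> ereal" where
  "blow_up_time \<Omega> T u =
     Inf (ereal ` {s. 0 < s \<and> ereal s \<le> T \<and>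
                      filterlim (\<lambda>t. SUP x\<in>closure \<Omega>. \<bar>u x t\<bar>) at_top (at_left s)})"

definition maximal_classical_solution ::
  "(real^'n) set \<Rightarrow> real \<Rightarrow> (real \<Rightarrow> real^'n) \<Rightarrow> (real^'n \<Rightarrow> real \<Rightarrow> real) \<Rightarrow> (real^'n \<Rightarrow> real) \<Rightarrow>
   ereal \<Rightarrow> (real^'n \<Rightarrow> real \<Rightarrow> real) \<Rightarrow> bool" where
  "maximal_classical_solution \<Omega> p g \<sigma> u0 T u \<longleftrightarrow>
     classical_solution \<Omega> p g \<sigma> u0 T u \<and>
     (\<nexists>T' v. T < T' \<and> classical_solution \<Omega> p g \<sigma> u0 T' v \<and>
             (\<forall>x\<in>closure \<Omega>. \<forall>t. 0 \<le> t \<and> ereal t < T \<longrightarrow> v x t = u x t)) \<and>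
     T = blow_up_time \<Omega> T u"

end

theory Submission
  imports Defs
begin

text \<open>
  Since \<open>1 / sup \<sigma>\<close> is integrable up to time \<open>0\<close> and \<open>\<sigma>\<close> is Lipschitz in time, \<open>\<sigma>\<close> has a positive
  lower bound \<open>m\<close> on every bounded time interval. If \<open>g\<^sub>j \<omega> \<ge> c \<omega> powr (p - 1)\<close> for large \<open>\<omega>\<close>, then
  \<open>exp (a + B t + K x\<^sub>j)\<close> with \<open>K = 1 / c\<close>, \<open>B > K\<^sup>2 + K / m\<close> and large \<open>a\<close> is a strict
  supersolution: convection in the direction \<open>x\<^sub>j\<close> absorbs the reaction term, and \<open>B\<close> absorbs
  diffusion and the boundary flux. A first-touching argument bounds \<open>u\<close> by it on every bounded
  time interval, so \<open>u\<close> cannot blow up in finite time.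
\<close>

section \<open>The outer unit normal\<close>

text \<open>The boundary point lies on the zero level of \<open>\<rho>\<close>, so the sign of the
  directional derivative decides on which side a short ray starts. The conclusions speak of
  \<open>\<Omega>\<close> only, which makes different defining functions comparable.\<close>

lemma C2_defining_function_direction:
  assumes C: "C2_defining_function \<Omega> U \<rho> D\<rho>" and x: "x \<in> U" and "open \<Omega>" "x \<in> frontier \<Omega>"
  shows "D\<rho> x \<bullet> d < 0 \<Longrightarrow> \<forall>\<^sub>F h in at_right 0. x + h *\<^sub>R d \<in> \<Omega>"
    and "D\<rho> x \<bullet> d > 0 \<Longrightarrow> \<forall>\<^sub>F h in at_right 0. x + h *\<^sub>R d \<notin> \<Omega>"
proof -
  have opU: "open U" and eq: "\<Omega> \<inter> U = {x\<in>U. \<rho> x < 0}"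
    and der: "(\<rho> has_derivative (\<lambda>h. D\<rho> x \<bullet> h)) (at x)"
    using C x unfolding C2_defining_function_def by auto
  have "x \<notin> \<Omega>"
    using assms(3,4) by (simp add: frontier_def interior_open)
  then have ge: "\<rho> x \<ge> 0"
    using eq x by (metis (mono_tags, lifting) IntD1 mem_Collect_eq not_less)
  \<comment> \<open>If \<open>\<rho> x\<close> were positive, \<open>\<rho>\<close> would be
    positive on a neighbourhood of \<open>x\<close>, which would then miss \<open>\<Omega>\<close>
    although \<open>x\<close> is in its closure.\<close>
  have "\<rho> x \<le> 0"
  proof (rule ccontr)
    assume "\<not> \<rho> x \<le> 0"
    have "continuous_on U \<rho>"
      using C unfolding C2_defining_function_def
      by (meson has_derivative_continuous continuous_at_imp_continuous_on)
    then have V: "open (U \<inter> \<rho> -` {0<..})"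
      using opU by (intro continuous_open_preimage) auto
    have xV: "x \<in> U \<inter> \<rho> -` {0<..}"
      using x \<open>\<not> \<rho> x \<le> 0\<close> by simp
    have "x \<in> closure \<Omega>"
      using assms(4) by (simp add: frontier_def)
    with V xV obtain y where "y \<in> \<Omega>" "y \<in> U \<inter> \<rho> -` {0<..}"
      using closure_iff_nhds_not_empty[of x \<Omega>] by blast
    then show False
      using eq by force
  qed
  with ge have zero: "\<rho> x = 0" by simp
  have lim: "((\<lambda>h. x + h *\<^sub>R d) \<longlongrightarrow> x) (at_right 0)"
    by (auto intro!: tendsto_eq_intros)
  have inU: "\<forall>\<^sub>F h in at_right 0. x + h *\<^sub>R d \<in> U"
    using topological_tendstoD[OF lim opU x] .
  have "((\<lambda>h. \<rho> (x + h *\<^sub>R d)) has_derivative (\<lambda>h. D\<rho> x \<bullet> (h *\<^sub>R d))) (at 0)"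
    by (rule has_derivative_compose[where g = \<rho>]) (auto intro!: derivative_eq_intros der)
  then have D: "((\<lambda>h. \<rho> (x + h *\<^sub>R d)) has_real_derivative D\<rho> x \<bullet> d) (at 0)"
    by (simp add: has_field_derivative_def mult_commute_abs)
  show "\<forall>\<^sub>F h in at_right 0. x + h *\<^sub>R d \<in> \<Omega>" if neg: "D\<rho> x \<bullet> d < 0"
  proof -
    obtain e where "e > 0" "\<And>h. 0 < h \<Longrightarrow> h < e \<Longrightarrow> \<rho> (x + h *\<^sub>R d) < 0"
      using DERIV_neg_dec_right[OF D neg] zero by auto
    then have "\<forall>\<^sub>F h in at_right 0. \<rho> (x + h *\<^sub>R d) < 0"
      unfolding eventually_at_right_field by auto
    with inU show ?thesis
      by eventually_elim (use eq in auto)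
  qed
  show "\<forall>\<^sub>F h in at_right 0. x + h *\<^sub>R d \<notin> \<Omega>" if pos: "D\<rho> x \<bullet> d > 0"
  proof -
    obtain e where "e > 0" "\<And>h. 0 < h \<Longrightarrow> h < e \<Longrightarrow> \<rho> (x + h *\<^sub>R d) > 0"
      using DERIV_pos_inc_right[OF D pos] zero by auto
    then have "\<forall>\<^sub>F h in at_right 0. \<rho> (x + h *\<^sub>R d) > 0"
      unfolding eventually_at_right_field by auto
    with inU show ?thesis
      by eventually_elim (use eq in force)
  qed
qed

text \<open>Expanding the square of \<open>norm (b - a)\<close> gives
  \<open>a \<bullet> b < 1\<close>. Hence \<open>b - a\<close> is a direction on which two distinct
  unit normals have opposite signs.\<close>

lemma inner_diff_unit_vectors_less:
  fixes a b :: "'a::real_inner"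
  assumes "norm a = 1" "norm b = 1" "a \<noteq> b"
  shows "a \<bullet> (b - a) < 0" "b \<bullet> (b - a) > 0"
proof -
  have "0 < (b - a) \<bullet> (b - a)"
    using assms(3) by simp
  moreover have "a \<bullet> a = 1" "b \<bullet> b = 1"
    using assms by (simp_all add: dot_square_norm)
  ultimately show "a \<bullet> (b - a) < 0" "b \<bullet> (b - a) > 0"
    by (simp_all add: inner_diff_left inner_diff_right inner_commute)
qed

text \<open>For a second candidate \<open>n\<close>, short rays in direction \<open>n - m\<close>
  would lie inside \<open>\<Omega>\<close> by one defining function and outside by the other. This
  uniqueness is what the definite description needs.\<close>

lemma outer_unit_normal_eq:
  assumes "open \<Omega>" "x \<in> frontier \<Omega>" "x \<in> U" "C2_defining_function \<Omega> U \<rho> D\<rho>"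
  shows "outer_unit_normal \<Omega> x = D\<rho> x /\<^sub>R norm (D\<rho> x)"
  unfolding outer_unit_normal_def
proof (rule the_equality)
  show "\<exists>V \<tau> D\<tau>. x \<in> V \<and> C2_defining_function \<Omega> V \<tau> D\<tau> \<and>
          D\<rho> x /\<^sub>R norm (D\<rho> x) = D\<tau> x /\<^sub>R norm (D\<tau> x)"
    using assms by blast
next
  fix n
  assume "\<exists>V \<tau> D\<tau>. x \<in> V \<and> C2_defining_function \<Omega> V \<tau> D\<tau> \<and> n = D\<tau> x /\<^sub>R norm (D\<tau> x)"
  then obtain V \<tau> D\<tau> where V: "x \<in> V" "C2_defining_function \<Omega> V \<tau> D\<tau>" and n: "n = D\<tau> x /\<^sub>R norm (D\<tau> x)"
    by blast
  define m where "m = D\<rho> x /\<^sub>R norm (D\<rho> x)"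
  have nz: "D\<rho> x \<noteq> 0" "D\<tau> x \<noteq> 0"
    using assms V unfolding C2_defining_function_def by auto
  have "norm m = 1" "norm n = 1"
    using nz by (simp_all add: m_def n)
  show "n = m"
  proof (rule ccontr)
    assume "n \<noteq> m"
    with \<open>norm m = 1\<close> \<open>norm n = 1\<close> have "m \<bullet> (n - m) < 0" "n \<bullet> (n - m) > 0"
      using inner_diff_unit_vectors_less[of m n] by auto
    moreover have "D\<rho> x = norm (D\<rho> x) *\<^sub>R m" "D\<tau> x = norm (D\<tau> x) *\<^sub>R n"
      using nz by (simp_all add: m_def n)
    ultimately have "D\<rho> x \<bullet> (n - m) < 0" "D\<tau> x \<bullet> (n - m) > 0"
      using nz by (metis inner_scaleR_left mult_pos_neg zero_less_norm_iff,
                   metis inner_scaleR_left mult_pos_pos zero_less_norm_iff)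
    then have "\<forall>\<^sub>F h in at_right 0. x + h *\<^sub>R (n - m) \<in> \<Omega>"
      "\<forall>\<^sub>F h in at_right 0. x + h *\<^sub>R (n - m) \<notin> \<Omega>"
      using C2_defining_function_direction assms V by blast+
    then have "\<forall>\<^sub>F h in at_right (0::real). False"
      by eventually_elim simp
    then show False
      by simp
  qed
qed

lemma outer_unit_normal_props:
  assumes "bounded_C2_domain \<Omega>" "x \<in> frontier \<Omega>"
  shows "norm (outer_unit_normal \<Omega> x) = 1"
    and "\<forall>\<^sub>F h in at_right 0. x + h *\<^sub>R (- outer_unit_normal \<Omega> x) \<in> \<Omega>"
proof -
  obtain U \<rho> D\<rho> where U: "x \<in> U" "C2_defining_function \<Omega> U \<rho> D\<rho>"
    using assms unfolding bounded_C2_domain_def by blast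
  have op: "open \<Omega>"
    using assms unfolding bounded_C2_domain_def by blast
  have nz: "D\<rho> x \<noteq> 0"
    using U unfolding C2_defining_function_def by auto
  have eq: "outer_unit_normal \<Omega> x = D\<rho> x /\<^sub>R norm (D\<rho> x)"
    using outer_unit_normal_eq[OF op assms(2) U] .
  show "norm (outer_unit_normal \<Omega> x) = 1"
    using nz by (simp add: eq)
  have "D\<rho> x \<bullet> (- outer_unit_normal \<Omega> x) < 0"
    using nz by (simp add: eq)
  then show "\<forall>\<^sub>F h in at_right 0. x + h *\<^sub>R (- outer_unit_normal \<Omega> x) \<in> \<Omega>"
    using C2_defining_function_direction(1)[OF U(2,1) op assms(2)] by blast
qed

section \<open>Necessary conditions at a maximum\<close>

text \<open>A negative value would make \<open>f\<close> increase along the inward normal, whose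
  initial segment lies in \<open>\<Omega>\<close>.\<close>

lemma normal_derivative_nonneg_at_max:
  assumes dom: "bounded_C2_domain \<Omega>" and x: "x \<in> frontier \<Omega>"
    and der: "(f has_derivative (\<lambda>h. D \<bullet> h)) (at x within closure \<Omega>)"
    and max: "\<And>y. y \<in> closure \<Omega> \<Longrightarrow> f y \<le> (f x :: real)"
  shows "D \<bullet> outer_unit_normal \<Omega> x \<ge> 0"
proof (rule ccontr)
  assume neg: "\<not> ?thesis"
  define n where "n = outer_unit_normal \<Omega> x"
  \<comment> \<open>\<open>f\<close> is differentiable only relative to
    \<open>closure \<Omega>\<close>, so the derivative along the ray is taken within the parameters
    that keep the ray there.\<close>
  define S where "S = {h. h \<ge> 0 \<and> x + h *\<^sub>R (- n) \<in> closure \<Omega>}"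
  have "(\<lambda>h. x + h *\<^sub>R (- n)) ` S \<subseteq> closure \<Omega>"
    by (auto simp: S_def)
  then have "(f has_derivative (\<lambda>h. D \<bullet> h)) (at (x + 0 *\<^sub>R (- n)) within (\<lambda>h. x + h *\<^sub>R (- n)) ` S)"
    using has_derivative_subset[OF der] by simp
  then have "((\<lambda>h. f (x + h *\<^sub>R (- n))) has_derivative (\<lambda>h. D \<bullet> (h *\<^sub>R (- n)))) (at 0 within S)"
    by (rule has_derivative_in_compose[rotated]) (auto intro!: derivative_eq_intros)
  moreover have "(\<lambda>h. D \<bullet> (h *\<^sub>R (- n))) = (*) (- (D \<bullet> n))"
    by auto
  ultimately have "((\<lambda>h. f (x + h *\<^sub>R (- n))) has_real_derivative - (D \<bullet> n)) (at 0 within S)"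
    by (simp only: has_field_derivative_def)
  then obtain d where d: "d > 0" "\<And>h. h > 0 \<Longrightarrow> h \<in> S \<Longrightarrow> h < d \<Longrightarrow> f x < f (x + h *\<^sub>R (- n))"
    using has_real_derivative_pos_inc_right[of "\<lambda>h. f (x + h *\<^sub>R (- n))" "- (D \<bullet> n)" 0 S] neg
    by (auto simp: n_def)
  obtain b where b: "b > 0" "\<And>h. h > 0 \<Longrightarrow> h < b \<Longrightarrow> x + h *\<^sub>R (- n) \<in> \<Omega>"
    using outer_unit_normal_props(2)[OF dom x] unfolding eventually_at_right_field n_def by auto
  define h where "h = min b d / 2"
  have h: "h > 0" "h < b" "h < d"
    using b d by (auto simp: h_def min_def)
  have "x + h *\<^sub>R (- n) \<in> closure \<Omega>"
    using b(2)[OF h(1,2)] closure_subset by blast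
  then show False
    using d(2)[of h] max[of "x + h *\<^sub>R (- n)"] h by (auto simp: S_def)
qed

text \<open>If \<open>c > 0\<close>, then \<open>f'\<close> is positive just to the right of its
  zero at \<open>0\<close>, and the mean value theorem pushes \<open>f\<close> above
  \<open>f 0\<close>.\<close>

lemma second_derivative_nonpos_at_max:
  fixes f :: "real \<Rightarrow> real"
  assumes "e > 0"
    and D: "\<And>s. \<bar>s\<bar> < e \<Longrightarrow> (f has_real_derivative f' s) (at s)"
    and D2: "(f' has_real_derivative c) (at 0)"
    and max: "\<And>s. \<bar>s\<bar> < e \<Longrightarrow> f s \<le> f 0"
  shows "c \<le> 0"
proof (rule ccontr)
  assume "\<not> c \<le> 0"
  then have "c > 0" by simp
  have z: "f' 0 = 0"
    using DERIV_local_max[OF D[of 0] \<open>e > 0\<close>] max \<open>e > 0\<close> by auto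
  obtain d where d: "d > 0" "\<And>h. h > 0 \<Longrightarrow> h < d \<Longrightarrow> f' 0 < f' (0 + h)"
    using DERIV_pos_inc_right[OF D2 \<open>c > 0\<close>] by blast
  define h where "h = min d e / 2"
  have h: "0 < h" "h < d" "h < e"
    using d \<open>e > 0\<close> by (auto simp: h_def min_def)
  have "\<exists>z>0. z < h \<and> f h - f 0 = (h - 0) * f' z"
    by (rule MVT2[OF \<open>0 < h\<close>]) (use h in \<open>auto intro!: D\<close>)
  then obtain s where "0 < s" "s < h" "f h - f 0 = h * f' s"
    by auto
  moreover have "f' s > 0"
    using d(2)[of s] \<open>0 < s\<close> \<open>s < h\<close> h z by simp
  ultimately show False
    using max[of h] h mult_pos_pos[of h "f' s"] by linarith
qed

text \<open>The trace sums the second derivatives along the coordinate axes, and the one-dimensional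
  test applies to each of them.\<close>

lemma hessian_trace_nonpos_at_max:
  fixes f :: "real^'n \<Rightarrow> real" and H :: "real^'n^'n"
  assumes op: "open S" and x: "x \<in> S"
    and D: "\<And>y. y \<in> S \<Longrightarrow> (f has_derivative (\<lambda>h. Df y \<bullet> h)) (at y)"
    and D2: "(Df has_derivative (\<lambda>h. H *v h)) (at x)"
    and max: "\<And>y. y \<in> S \<Longrightarrow> f y \<le> f x"
  shows "Df x = 0" and "trace H \<le> 0"
proof -
  obtain e where e: "e > 0" "ball x e \<subseteq> S"
    using op x open_contains_ball by blast
  have "(\<lambda>h. Df x \<bullet> h) = (\<lambda>h. 0)"
    using differential_zero_maxmin[OF x op D[OF x]] max by blast
  then have "Df x \<bullet> Df x = 0"
    by metis
  then show "Df x = 0"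
    by simp
  have "H $ i $ i \<le> 0" for i
  proof (rule second_derivative_nonpos_at_max[OF e(1)])
    let ?e = "axis i 1 :: real^'n"
    have mem: "x + s *\<^sub>R ?e \<in> S" if "\<bar>s\<bar> < e" for s
      using that e(2) by (auto simp: dist_norm subset_eq)
    show "f (x + s *\<^sub>R ?e) \<le> f (x + 0 *\<^sub>R ?e)" if "\<bar>s\<bar> < e" for s
      using max[OF mem[OF that]] by simp
    show "((\<lambda>s. f (x + s *\<^sub>R ?e)) has_real_derivative Df (x + s *\<^sub>R ?e) \<bullet> ?e) (at s)"
      if "\<bar>s\<bar> < e" for s
    proof -
      have "((\<lambda>s. f (x + s *\<^sub>R ?e)) has_derivative (\<lambda>h. Df (x + s *\<^sub>R ?e) \<bullet> (h *\<^sub>R ?e))) (at s)"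
        by (rule has_derivative_compose[where g = f]) (auto intro!: derivative_eq_intros D mem that)
      then show ?thesis
        by (simp add: has_field_derivative_def mult_commute_abs)
    qed
    have "((\<lambda>s. Df (x + s *\<^sub>R ?e)) has_derivative (\<lambda>h. H *v (h *\<^sub>R ?e))) (at 0)"
      by (rule has_derivative_compose[where g = Df]) (auto intro!: derivative_eq_intros simp: D2)
    then have "((\<lambda>s. Df (x + s *\<^sub>R ?e) \<bullet> ?e) has_derivative (\<lambda>h. (H *v (h *\<^sub>R ?e)) \<bullet> ?e)) (at 0)"
      by (rule has_derivative_inner_left)
    moreover have "(\<lambda>h. (H *v (h *\<^sub>R ?e)) \<bullet> ?e) = (*) (H $ i $ i)"
      by (auto simp: matrix_vector_mult_scaleR inner_axis matrix_vector_mul_component)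
    ultimately show "((\<lambda>s. Df (x + s *\<^sub>R ?e) \<bullet> ?e) has_real_derivative H $ i $ i) (at 0)"
      by (simp add: has_field_derivative_def)
  qed
  then show "trace H \<le> 0"
    by (simp add: trace_def sum_nonpos)
qed

section \<open>Comparison\<close>

lemma C21_with_derivativesD:
  assumes "C21_with_derivatives \<Omega> T u ut Du D2u" "x \<in> closure \<Omega>" "0 < t" "ereal t < T"
  shows "((\<lambda>s. u x s) has_real_derivative ut x t) (at t)"
    and "((\<lambda>y. u y t) has_derivative (\<lambda>h. Du x t \<bullet> h)) (at x within closure \<Omega>)"
    and "((\<lambda>y. Du y t) has_derivative (\<lambda>h. D2u x t *v h)) (at x within closure \<Omega>)"
  using assms unfolding C21_with_derivatives_def Let_def by auto

text \<open>At a first touching time only earlier times can be compared, which yields a sign of the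
  derivative instead of its vanishing.\<close>

lemma has_real_derivative_nonneg_at_left_max:
  fixes f :: "real \<Rightarrow> real"
  assumes "(f has_real_derivative l) (at t)" "a < t" "\<And>s. a < s \<Longrightarrow> s < t \<Longrightarrow> f s \<le> f t"
  shows "l \<ge> 0"
proof (rule ccontr)
  assume "\<not> l \<ge> 0"
  then obtain d where d: "d > 0" "\<And>h. h > 0 \<Longrightarrow> h < d \<Longrightarrow> f t < f (t - h)"
    using DERIV_neg_dec_left[OF assms(1)] by auto
  define h where "h = min d (t - a) / 2"
  have "h > 0" "h < d" "h < t - a"
    using d assms(2) by (auto simp: h_def min_def)
  then show False
    using d(2)[of h] assms(3)[of "t - h"] by auto
qed

text \<open>\<open>t\<close> is the least time in the compact set where \<open>w\<close> is
  nonnegative. Before it \<open>w\<close> is negative, and a left limit gives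
  \<open>w \<le> 0\<close> at time \<open>t\<close> on all of \<open>X\<close>, so the value at the
  touching point is exactly zero.\<close>

lemma first_touching_point:
  fixes w :: "'a::metric_space \<Rightarrow> real \<Rightarrow> real"
  assumes "compact X" and cont: "continuous_on (X \<times> {0..b}) (\<lambda>(x,t). w x t)"
    and init: "\<And>x. x \<in> X \<Longrightarrow> w x 0 < 0"
    and ex: "\<exists>x\<in>X. \<exists>t\<in>{0..b}. w x t \<ge> 0"
  obtains x t where "x \<in> X" "0 < t" "t \<le> b" "w x t = 0"
    "\<And>y. y \<in> X \<Longrightarrow> w y t \<le> 0" "\<And>y s. y \<in> X \<Longrightarrow> 0 \<le> s \<Longrightarrow> s < t \<Longrightarrow> w y s < 0"
proof -
  define S where "S = (X \<times> {0..b}) \<inter> (\<lambda>(x,t). w x t) -` {0..}"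
  have "closedin (top_of_set (X \<times> {0..b})) S"
    unfolding S_def by (rule continuous_closedin_preimage[OF cont closed_atLeast])
  then have "compact S"
    using closedin_compact \<open>compact X\<close> compact_Times compact_Icc by blast
  then have "compact (snd ` S)"
    by (rule compact_continuous_image[OF continuous_on_snd[OF continuous_on_id]])
  moreover have "snd ` S \<noteq> {}"
    using ex unfolding S_def by auto
  ultimately obtain t where t: "t \<in> snd ` S" "\<And>s. s \<in> snd ` S \<Longrightarrow> t \<le> s"
    using compact_attains_inf by metis
  obtain x where x: "x \<in> X" "0 \<le> t" "t \<le> b" "w x t \<ge> 0"
    using t(1) unfolding S_def by auto
  have "t > 0"
    using init[of x] x by (cases "t = 0") auto
  have before: "w y s < 0" if "y \<in> X" "0 \<le> s" "s < t" for y s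
  proof (rule ccontr)
    assume "\<not> w y s < 0"
    then have "(y, s) \<in> S"
      using that x by (auto simp: S_def)
    then have "t \<le> s"
      using t(2)[of s] by force
    then show False using that by simp
  qed
  have le: "w y t \<le> 0" if y: "y \<in> X" for y
  proof -
    have "continuous_on {0..b} (\<lambda>s. (case (y, s) of (x,t) \<Rightarrow> w x t))"
      by (rule continuous_on_compose2[OF cont]) (use y in \<open>auto intro!: continuous_intros\<close>)
    then have "continuous_on {0..t} (w y)"
      using x by (auto intro: continuous_on_subset)
    then have "(w y \<longlongrightarrow> w y t) (at t within {0..t})"
      using \<open>t > 0\<close> by (auto simp: continuous_on_def)
    then have "(w y \<longlongrightarrow> w y t) (at_left t)"
      using \<open>t > 0\<close> by (simp add: at_within_Icc_at_left)
    moreover have "\<forall>\<^sub>F s in at_left t. w y s \<le> 0"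
      unfolding eventually_at_left_field
      using \<open>t > 0\<close> before[OF y] by (intro exI[of _ 0]) (auto intro: less_imp_le)
    ultimately show ?thesis
      by (rule tendsto_upperbound) simp
  qed
  show ?thesis
    using that[of x t] x \<open>t > 0\<close> le before by (meson order_antisym)
qed

text \<open>
  At the first time the graphs touch, the maximum conditions for \<open>u - v\<close> contradict the
  strictness of the inequalities for \<open>v\<close>. Since \<open>u = v\<close> and, inside \<open>\<Omega>\<close>, also \<open>Du = Dv\<close> at the
  touching point, no regularity of the nonlinearities is needed.
\<close>

lemma strict_comparison:
  fixes u v :: "real^'n \<Rightarrow> real \<Rightarrow> real"
  assumes dom: "bounded_C2_domain \<Omega>"
    and contu: "continuous_on (closure \<Omega> \<times> {t. 0 \<le> t \<and> ereal t < T}) (\<lambda>(x,t). u x t)"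
    and contv: "continuous_on (closure \<Omega> \<times> {t. 0 \<le> t \<and> ereal t < T}) (\<lambda>(x,t). v x t)"
    and C21u: "C21_with_derivatives \<Omega> T u ut Du D2u"
    and C21v: "C21_with_derivatives \<Omega> T v vt Dv D2v"
    and init: "\<And>x. x \<in> closure \<Omega> \<Longrightarrow> u x 0 < v x 0"
    and pdeu: "\<And>x t. x \<in> \<Omega> \<Longrightarrow> 0 < t \<Longrightarrow> ereal t < T \<Longrightarrow>
      ut x t \<le> trace (D2u x t) - g (u x t) \<bullet> Du x t + f (u x t)"
    and pdev: "\<And>x t. x \<in> \<Omega> \<Longrightarrow> 0 < t \<Longrightarrow> ereal t < T \<Longrightarrow>
      vt x t > trace (D2v x t) - g (v x t) \<bullet> Dv x t + f (v x t)"
    and \<sigma>: "\<And>x t. x \<in> frontier \<Omega> \<Longrightarrow> 0 < t \<Longrightarrow> ereal t < T \<Longrightarrow> \<sigma> x t \<ge> 0"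
    and bdu: "\<And>x t. x \<in> frontier \<Omega> \<Longrightarrow> 0 < t \<Longrightarrow> ereal t < T \<Longrightarrow>
      \<sigma> x t * ut x t + Du x t \<bullet> outer_unit_normal \<Omega> x \<le> 0"
    and bdv: "\<And>x t. x \<in> frontier \<Omega> \<Longrightarrow> 0 < t \<Longrightarrow> ereal t < T \<Longrightarrow>
      \<sigma> x t * vt x t + Dv x t \<bullet> outer_unit_normal \<Omega> x > 0"
    and x: "x \<in> closure \<Omega>" and t: "0 \<le> t" "ereal t < T"
  shows "u x t < v x t"
proof (rule ccontr)
  assume neg: "\<not> u x t < v x t"
  have op: "open \<Omega>" and bd: "bounded \<Omega>"
    using dom unfolding bounded_C2_domain_def by auto
  have "continuous_on (closure \<Omega> \<times> {t. 0 \<le> t \<and> ereal t < T}) (\<lambda>z. (\<lambda>(x,t). u x t) z - (\<lambda>(x,t). v x t) z)"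
    by (intro continuous_on_diff contu contv)
  then have contw: "continuous_on (closure \<Omega> \<times> {0..t}) (\<lambda>(x,t). u x t - v x t)"
    by (rule continuous_on_subset[OF continuous_on_eq])
      (use t in \<open>auto intro: le_less_trans[of _ "ereal t"]\<close>)
  obtain y s where y: "y \<in> closure \<Omega>" and s: "0 < s" "s \<le> t" and touch: "u y s - v y s = 0"
    and le: "\<And>z. z \<in> closure \<Omega> \<Longrightarrow> u z s - v z s \<le> 0"
    and before: "\<And>z r. z \<in> closure \<Omega> \<Longrightarrow> 0 \<le> r \<Longrightarrow> r < s \<Longrightarrow> u z r - v z r < 0"
  proof (rule first_touching_point[OF _ contw])
    show "compact (closure \<Omega>)"
      using bd by (simp add: compact_closure)
    show "u z 0 - v z 0 < 0" if "z \<in> closure \<Omega>" for z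
      using init[OF that] by simp
    show "\<exists>x\<in>closure \<Omega>. \<exists>s\<in>{0..t}. 0 \<le> u x s - v x s"
      using x t neg by (intro bexI[of _ x] bexI[of _ t]) auto
  qed blast
  have sT: "ereal s < T"
    using s t by (auto intro: le_less_trans[of _ "ereal t"])
  note Du = C21_with_derivativesD[OF C21u _ s(1) sT] and Dv = C21_with_derivativesD[OF C21v _ s(1) sT]
  have "ut y s - vt y s \<ge> 0"
    by (rule has_real_derivative_nonneg_at_left_max[OF DERIV_diff[OF Du(1) Dv(1)], where a = 0])
      (use y s touch before in \<open>auto intro: less_imp_le\<close>)
  have dw: "((\<lambda>z. u z s - v z s) has_derivative (\<lambda>h. (Du z s - Dv z s) \<bullet> h)) (at z within closure \<Omega>)"
    if "z \<in> closure \<Omega>" for z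
    using has_derivative_diff[OF Du(2)[OF that] Dv(2)[OF that]] by (simp add: inner_diff_left)
  show False
  proof (cases "y \<in> \<Omega>")
    case True
    have within: "at z within closure \<Omega> = at z" if "z \<in> \<Omega>" for z
      using that op closure_subset[of \<Omega>] by (meson at_within_open_subset)
    have dd: "((\<lambda>z. Du z s - Dv z s) has_derivative (\<lambda>h. (D2u y s - D2v y s) *v h)) (at y)"
      using has_derivative_diff[OF Du(3)[OF y] Dv(3)[OF y]] True
      by (simp add: within matrix_vector_mult_diff_rdistrib)
    \<comment> \<open>The convection and reaction terms now agree, leaving
      \<open>ut y s - vt y s < trace (D2u y s - D2v y s)\<close>, against the sign of the time
      derivative.\<close>
    have "Du y s - Dv y s = 0" "trace (D2u y s - D2v y s) \<le> 0"
      using hessian_trace_nonpos_at_max[OF op True _ dd, of "\<lambda>z. u z s - v z s"]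
        dw within le touch closure_subset[of \<Omega>] by fastforce+
    then show False
      using pdeu[OF True s(1) sT] pdev[OF True s(1) sT] touch \<open>ut y s - vt y s \<ge> 0\<close>
      by (simp add: trace_sub)
  next
    case False
    then have fr: "y \<in> frontier \<Omega>"
      using y op by (simp add: frontier_def interior_open)
    \<comment> \<open>As \<open>\<sigma> \<ge> 0\<close>, both terms of the boundary expression are
      at least as large for \<open>u\<close> as for \<open>v\<close>, yet it is nonpositive for
      \<open>u\<close> and positive for \<open>v\<close>.\<close>
    have "(Du y s - Dv y s) \<bullet> outer_unit_normal \<Omega> y \<ge> 0"
      by (rule normal_derivative_nonneg_at_max[OF dom fr dw[OF y]]) (use le touch in auto)
    moreover have "\<sigma> y s * vt y s \<le> \<sigma> y s * ut y s"
      using \<sigma>[OF fr s(1) sT] \<open>ut y s - vt y s \<ge> 0\<close> by (intro mult_left_mono) auto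
    ultimately show False
      using bdu[OF fr s(1) sT] bdv[OF fr s(1) sT] by (simp add: inner_diff_left)
  qed
qed

section \<open>A positive lower bound for the boundary coefficient\<close>

text \<open>For fixed \<open>x\<close> the time line stays in \<open>F \<times> {0<..}\<close>, so
  the bounded joint derivative applied to \<open>(0, h)\<close> bounds the time derivative, and the
  mean value inequality applies on the half-line.\<close>

lemma C1_bounded_on_lipschitz_in_time:
  fixes \<sigma> :: "'a::euclidean_space \<Rightarrow> real \<Rightarrow> real"
  assumes "C1_bounded_on (F \<times> {0<..}) (\<lambda>(x,t). \<sigma> x t)"
  obtains L where "L \<ge> 1"
    "\<And>x s t. x \<in> F \<Longrightarrow> 0 < s \<Longrightarrow> 0 < t \<Longrightarrow> \<bar>\<sigma> x s - \<sigma> x t\<bar> \<le> L * \<bar>s - t\<bar>"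
proof -
  obtain D :: "'a \<times> real \<Rightarrow> ('a \<times> real) \<Rightarrow>\<^sub>L real" where bd: "bounded (D ` (F \<times> {0<..}))"
    and D: "\<And>z. z \<in> F \<times> {0<..} \<Longrightarrow>
      ((\<lambda>(x,t). \<sigma> x t) has_derivative blinfun_apply (D z)) (at z within (F \<times> {0<..}))"
    using assms unfolding C1_bounded_on_def by blast
  obtain B where B: "\<And>z. z \<in> F \<times> {0<..} \<Longrightarrow> norm (D z) \<le> B"
    using bd unfolding bounded_iff by blast
  \<comment> \<open>The maximum with \<open>1\<close> keeps the constant positive, since it becomes
    a divisor below.\<close>
  have "\<bar>\<sigma> x s - \<sigma> x t\<bar> \<le> max 1 B * \<bar>s - t\<bar>" if x: "x \<in> F" and "0 < s" "0 < t" for x s t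
  proof -
    have der: "(\<sigma> x has_derivative (\<lambda>h. D (x, r) (0, h))) (at r within {0<..})" if "r \<in> {0<..}" for r
    proof -
      have "((\<lambda>r. (\<lambda>(x,t). \<sigma> x t) (x, r)) has_derivative (\<lambda>h. D (x, r) (0, h))) (at r within {0<..})"
        by (rule has_derivative_in_compose2[where t = "F \<times> {0<..}" and g' = "\<lambda>z. blinfun_apply (D z)", OF D])
          (use x that in \<open>auto intro!: derivative_eq_intros\<close>)
      then show ?thesis by simp
    qed
    have "norm (\<sigma> x s - \<sigma> x t) \<le> max 1 B * norm (s - t)"
    proof (rule differentiable_bound[OF _ der])
      show "onorm (\<lambda>h. D (x, r) (0, h)) \<le> max 1 B" if "r \<in> {0<..}" for r
      proof (rule onorm_bound)
        show "norm (D (x, r) (0, h)) \<le> max 1 B * norm h" for h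
        proof -
          have "norm (D (x, r) (0, h)) \<le> norm (D (x, r)) * norm ((0, h) :: 'a \<times> real)"
            by (rule norm_blinfun)
          also have "\<dots> \<le> max 1 B * norm h"
            using B[of "(x, r)"] x that by (auto simp: norm_Pair intro!: mult_right_mono)
          finally show ?thesis .
        qed
      qed simp
    qed (use that in auto)
    then show ?thesis by simp
  qed
  then show ?thesis
    using that[of "max 1 B"] by simp
qed

text \<open>
  If \<open>s a < \<epsilon>\<close>, then \<open>s t < \<epsilon> + L (t - a)\<close> after \<open>a\<close>, and the integral of the reciprocal of
  the right-hand side over \<open>[a, a + 1]\<close> is of order \<open>ln (1 / \<epsilon>)\<close>, uniformly in \<open>a\<close>.
\<close>

lemma L1_loc_halfline_inverse_imp_lower_bound:
  fixes s :: "real \<Rightarrow> real"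
  assumes L1: "L1_loc_halfline (\<lambda>t. inverse (ennreal (s t)))"
    and "L \<ge> 1" and lip: "\<And>a b. 0 < a \<Longrightarrow> a \<le> b \<Longrightarrow> s b \<le> s a + L * (b - a)"
    and "R > 0"
  obtains \<epsilon> where "\<epsilon> > 0" "\<And>t. 0 < t \<Longrightarrow> t \<le> R \<Longrightarrow> s t \<ge> \<epsilon>"
proof -
  \<comment> \<open>The upper limit \<open>R + 1\<close> leaves room for the interval from
    \<open>a\<close> to \<open>a + 1\<close> for every \<open>a \<le> R\<close>.\<close>
  let ?I = "\<integral>\<^sup>+t\<in>{0<..R + 1}. inverse (ennreal (s t)) \<partial>lebesgue"
  have "?I < \<infinity>"
    using L1 \<open>R > 0\<close> unfolding L1_loc_halfline_def by simp
  then obtain I where I: "?I = ennreal I" "I \<ge> 0"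
    by (cases ?I) auto
  \<comment> \<open>Chosen so that \<open>ln (L / \<epsilon>) / L = I + 1\<close>, one more than the
    available integral.\<close>
  define \<epsilon> where "\<epsilon> = L * exp (- (L * (I + 1)))"
  have "\<epsilon> > 0"
    using \<open>L \<ge> 1\<close> by (simp add: \<epsilon>_def)
  have "s a \<ge> \<epsilon>" if a: "0 < a" "a \<le> R" for a
  proof (rule ccontr)
    assume small: "\<not> s a \<ge> \<epsilon>"
    define F where "F = (\<lambda>t. ln (\<epsilon> + L * (t - a)) / L)"
    have pos: "\<epsilon> + L * (t - a) > 0" if "a \<le> t" for t
      using that \<open>\<epsilon> > 0\<close> \<open>L \<ge> 1\<close> by (simp add: add_pos_nonneg)
    have "L / \<epsilon> = exp (L * (I + 1))"
      using \<open>L \<ge> 1\<close> by (simp add: \<epsilon>_def exp_minus inverse_eq_divide)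
    then have "I + 1 = ln (L / \<epsilon>) / L"
      using \<open>L \<ge> 1\<close> by simp
    also have "\<dots> \<le> ln ((\<epsilon> + L) / \<epsilon>) / L"
      using \<open>L \<ge> 1\<close> \<open>\<epsilon> > 0\<close> by (intro divide_right_mono ln_mono divide_pos_pos) auto
    also have "\<dots> = F (a + 1) - F a"
      using \<open>L \<ge> 1\<close> \<open>\<epsilon> > 0\<close> by (simp add: F_def ln_div diff_divide_distrib)
    finally have "ennreal (I + 1) \<le> ennreal (F (a + 1) - F a)"
      by (rule ennreal_leI)
    also have "\<dots> = (\<integral>\<^sup>+t. ennreal (1 / (\<epsilon> + L * (t - a))) * indicator {a..a + 1} t \<partial>lborel)"
    proof (rule nn_integral_FTC_Icc[where F = F, symmetric])
      show "(F has_real_derivative 1 / (\<epsilon> + L * (t - a))) (at t)" if "t \<in> {a..a + 1}" for t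
        unfolding F_def using that pos[of t] \<open>L \<ge> 1\<close> by (auto intro!: derivative_eq_intros)
    qed (use pos in \<open>auto intro: less_imp_le\<close>)
    also have "\<dots> \<le> (\<integral>\<^sup>+t\<in>{0<..R + 1}. inverse (ennreal (s t)) \<partial>lborel)"
    proof (rule nn_integral_mono)
      fix t
      show "ennreal (1 / (\<epsilon> + L * (t - a))) * indicator {a..a + 1} t
        \<le> inverse (ennreal (s t)) * indicator {0<..R + 1} t"
      proof (cases "t \<in> {a..a + 1}")
        case True
        then have "s t \<le> \<epsilon> + L * (t - a)"
          using lip[of a t] a small by auto
        \<comment> \<open>If \<open>s t \<le> 0\<close>, then \<open>ennreal (s t)\<close> is
          \<open>0\<close> and its inverse is infinite, so the inequality holds there too.\<close>
        then have "inverse (ennreal (\<epsilon> + L * (t - a))) \<le> inverse (ennreal (s t))"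
          using pos[of t] True
          by (cases "s t \<le> 0") (auto simp: ennreal_neg inverse_ennreal intro!: ennreal_leI le_imp_inverse_le)
        then show ?thesis
          using True a pos[of t] by (simp add: inverse_ennreal inverse_eq_divide)
      qed simp
    qed
    \<comment> \<open>Passing to the completion \<open>lebesgue\<close> of \<open>lborel\<close>
      does not change the nonnegative integral.\<close>
    also have "\<dots> = ennreal I"
      using I by (simp add: nn_integral_completion)
    finally show False
      using I(2) by (simp add: ennreal_le_iff)
  qed
  then show ?thesis
    using that \<open>\<epsilon> > 0\<close> by blast
qed

text \<open>The integrability argument controls the supremum over \<open>F\<close>; comparability of
  infimum and supremum turns this into the pointwise bound
  \<open>\<delta> * \<epsilon>\<close>.\<close>

lemma boundary_coefficient_lower_bound:
  fixes \<sigma> :: "'a::euclidean_space \<Rightarrow> real \<Rightarrow> real"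
  assumes "F \<noteq> {}" and C1: "C1_bounded_on (F \<times> {0<..}) (\<lambda>(x,t). \<sigma> x t)"
    and nonneg: "\<forall>x\<in>F. \<forall>t>0. \<sigma> x t \<ge> 0" and "\<delta> > 0"
    and osc: "\<forall>t>0. (INF x\<in>F. \<sigma> x t) \<ge> \<delta> * (SUP x\<in>F. \<sigma> x t)"
    and L1: "L1_loc_halfline (\<lambda>t. inverse (ennreal (SUP x\<in>F. \<sigma> x t)))"
    and "R > 0"
  obtains m where "m > 0" "\<And>x t. x \<in> F \<Longrightarrow> 0 < t \<Longrightarrow> t \<le> R \<Longrightarrow> \<sigma> x t \<ge> m"
proof -
  obtain L where L: "L \<ge> 1"
    "\<And>x s t. x \<in> F \<Longrightarrow> 0 < s \<Longrightarrow> 0 < t \<Longrightarrow> \<bar>\<sigma> x s - \<sigma> x t\<bar> \<le> L * \<bar>s - t\<bar>"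
    using C1_bounded_on_lipschitz_in_time[OF C1] by blast
  have "bounded ((\<lambda>(x,t). \<sigma> x t) ` (F \<times> {0<..}))"
    using C1 unfolding C1_bounded_on_def by blast
  then obtain M where M: "\<And>x t. x \<in> F \<Longrightarrow> 0 < t \<Longrightarrow> \<bar>\<sigma> x t\<bar> \<le> M"
    unfolding bounded_iff by fastforce
  have bdd: "bdd_above ((\<lambda>x. \<sigma> x t) ` F)" if "t > 0" for t
    using M[OF _ that] by (intro bdd_aboveI[of _ M]) (force dest: abs_le_D1)
  \<comment> \<open>The supremum inherits the one-sided Lipschitz bound because \<open>L\<close>
    does not depend on \<open>x\<close>.\<close>
  have lip: "(SUP x\<in>F. \<sigma> x b) \<le> (SUP x\<in>F. \<sigma> x a) + L * (b - a)" if ab: "0 < a" "a \<le> b" for a b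
  proof (rule cSUP_least[OF \<open>F \<noteq> {}\<close>])
    fix x assume x: "x \<in> F"
    have "\<sigma> x b \<le> \<sigma> x a + L * (b - a)"
      using L(2)[OF x, of b a] ab by auto
    also have "\<sigma> x a \<le> (SUP x\<in>F. \<sigma> x a)"
      using bdd[OF ab(1)] x by (rule cSUP_upper2) simp
    finally show "\<sigma> x b \<le> (SUP x\<in>F. \<sigma> x a) + L * (b - a)" by simp
  qed
  obtain \<epsilon> where e: "\<epsilon> > 0" "\<And>t. 0 < t \<Longrightarrow> t \<le> R \<Longrightarrow> (SUP x\<in>F. \<sigma> x t) \<ge> \<epsilon>"
    using L1_loc_halfline_inverse_imp_lower_bound[OF L1 L(1) lip \<open>R > 0\<close>] by blast
  show ?thesis
  proof
    show "\<delta> * \<epsilon> > 0"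
      using e \<open>\<delta> > 0\<close> by simp
    fix x t assume x: "x \<in> F" and t: "0 < t" "t \<le> R"
    have "\<delta> * \<epsilon> \<le> \<delta> * (SUP x\<in>F. \<sigma> x t)"
      using e(2)[OF t] \<open>\<delta> > 0\<close> by simp
    also have "\<dots> \<le> (INF x\<in>F. \<sigma> x t)"
      using osc t by simp
    also have "\<dots> \<le> \<sigma> x t"
      by (rule cINF_lower) (use nonneg t x in \<open>auto intro!: bdd_belowI[of _ 0]\<close>)
    finally show "\<sigma> x t \<ge> \<delta> * \<epsilon>" .
  qed
qed

section \<open>Exponential supersolutions\<close>

text \<open>Dependence on space through \<open>x $ j\<close> alone makes the gradient a multiple of
  \<open>axis j 1\<close> and leaves a single Hessian entry, so convection sees only component
  \<open>j\<close> of \<open>g\<close>.\<close>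

lemma C21_with_derivatives_exp:
  fixes j :: "'n::finite"
  shows "C21_with_derivatives \<Omega> T (\<lambda>x t. exp (a + B * t + K * x $ j))
     (\<lambda>x t. B * exp (a + B * t + K * x $ j))
     (\<lambda>x t. (K * exp (a + B * t + K * x $ j)) *\<^sub>R axis j 1)
     (\<lambda>x t. (K\<^sup>2 * exp (a + B * t + K * x $ j)) *\<^sub>R (\<chi> k l. if k = j \<and> l = j then 1 else 0))"
proof -
  have mat: "(\<chi> k l. if k = j \<and> l = j then 1 else 0) *v h = h $ j *\<^sub>R axis j 1" for h :: "real^'n"
    by (simp add: vec_eq_iff matrix_vector_mult_def axis_def if_distrib[of "\<lambda>x. x * _"] cong: if_cong)
  note vec_nth = bounded_linear_imp_has_derivative[OF bounded_linear_vec_nth]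
  have "((\<lambda>s. exp (a + B * s + K * x $ j)) has_real_derivative B * exp (a + B * t + K * x $ j)) (at t)"
    for x :: "real^'n" and t
    by (auto intro!: derivative_eq_intros)
  moreover have E: "((\<lambda>y. exp (a + B * t + K * y $ j)) has_derivative
      (\<lambda>h. ((K * exp (a + B * t + K * x $ j)) *\<^sub>R axis j 1) \<bullet> h)) (at x within S)"
    for x :: "real^'n" and t S
    unfolding inner_scaleR_left inner_axis' by (auto intro!: derivative_eq_intros vec_nth)
  moreover have "((\<lambda>y. (K * exp (a + B * t + K * y $ j)) *\<^sub>R axis j 1) has_derivative
      (\<lambda>h. (((K\<^sup>2 * exp (a + B * t + K * x $ j)) *\<^sub>R (\<chi> k l. if k = j \<and> l = j then 1 else 0)) *v h :: real^'n))) (at x within S)"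
    for x :: "real^'n" and t S
    by (auto intro!: derivative_eq_intros vec_nth
        simp: scaleR_matrix_vector_assoc[symmetric] mat fun_eq_iff power2_eq_square)
  ultimately show ?thesis
    unfolding C21_with_derivatives_def Let_def
    by (auto simp del: inner_scaleR_left simp: case_prod_beta intro!: continuous_intros)
qed

section \<open>Global existence from an explicit upper bound\<close>

theorem theorem3p2:
  fixes \<Omega> :: "(real^'n) set"
    and p :: real
    and g :: "real \<Rightarrow> real^'n"
    and \<sigma> :: "real^'n \<Rightarrow> real \<Rightarrow> real"
    and \<delta> :: real
    and u0 :: "real^'n \<Rightarrow> real"
    and T :: ereal
    and u :: "real^'n \<Rightarrow> real \<Rightarrow> real"
  assumes "bounded_C2_domain \<Omega>"
    and "p > 1"
    and "g C1_differentiable_on UNIV"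
    and "C1_bounded_on (frontier \<Omega> \<times> {0<..}) (\<lambda>(x,t). \<sigma> x t)"
    and "\<forall>x\<in>frontier \<Omega>. \<forall>t>0. \<sigma> x t \<ge> 0"
    and "\<delta> > 0"
    and "\<forall>t>0. (INF x\<in>frontier \<Omega>. \<sigma> x t) \<ge> \<delta> * (SUP x\<in>frontier \<Omega>. \<sigma> x t)"
    and "L1_loc_halfline (\<lambda>t. inverse (ennreal (SUP x\<in>frontier \<Omega>. \<sigma> x t)))"
    and "continuous_on (closure \<Omega>) u0"
    and "\<forall>x\<in>closure \<Omega>. u0 x \<ge> 0"
    and "\<exists>x\<in>closure \<Omega>. u0 x \<noteq> 0"
    and "\<exists>j. Liminf at_top (\<lambda>\<omega>. ereal (g \<omega> $ j / \<omega> powr (p - 1))) > 0"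
    and "maximal_classical_solution \<Omega> p g \<sigma> u0 T u"
  shows "T = \<infinity>"
proof (rule ccontr)
  assume "T \<noteq> \<infinity>"
  have sol: "classical_solution \<Omega> p g \<sigma> u0 T u" and bT: "T = blow_up_time \<Omega> T u"
    using assms(13) unfolding maximal_classical_solution_def by auto
  have "T > 0"
    using sol unfolding classical_solution_def by blast
  with \<open>T \<noteq> \<infinity>\<close> obtain R where R: "T = ereal R" "R > 0"
    by (cases T) auto
  have dom: "open \<Omega>" "\<Omega> \<noteq> {}" "bounded \<Omega>"
    using assms(1) unfolding bounded_C2_domain_def by auto
  \<comment> \<open>A nonempty bounded set is not the whole space. Suprema and infima over the
    boundary need it to be nonempty.\<close>
  have "frontier \<Omega> \<noteq> {}"
    using dom not_bounded_UNIV by (intro frontier_not_empty) auto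
  then obtain m where m: "m > 0" "\<And>x t. x \<in> frontier \<Omega> \<Longrightarrow> 0 < t \<Longrightarrow> t \<le> R \<Longrightarrow> \<sigma> x t \<ge> m"
    using boundary_coefficient_lower_bound[OF _ assms(4,5,6,7,8) R(2)] by blast
  obtain j where j: "Liminf at_top (\<lambda>\<omega>. ereal (g \<omega> $ j / \<omega> powr (p - 1))) > 0"
    using assms(12) by blast
  \<comment> \<open>The lower limit may be infinite, so a real \<open>c\<close> strictly below it is
    taken.\<close>
  obtain c where c: "0 < c" "ereal c < Liminf at_top (\<lambda>\<omega>. ereal (g \<omega> $ j / \<omega> powr (p - 1)))"
    using ereal_dense2[OF j] by auto
  have "\<forall>\<^sub>F \<omega> in at_top. ereal c < ereal (g \<omega> $ j / \<omega> powr (p - 1))"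
    using c(2) by (rule less_LiminfD)
  then obtain W0 where W0: "\<And>\<omega>. \<omega> \<ge> W0 \<Longrightarrow> c < g \<omega> $ j / \<omega> powr (p - 1)"
    unfolding eventually_at_top_linorder by auto
  define W where "W = max 1 W0"
  have W: "c * \<omega> powr p \<le> g \<omega> $ j * \<omega>" if "\<omega> \<ge> W" for \<omega>
  proof -
    have w: "\<omega> > 0" "\<omega> \<ge> W0"
      using that by (auto simp: W_def)
    have "c * \<omega> powr (p - 1) \<le> g \<omega> $ j"
      using W0[OF w(2)] w(1) by (simp add: less_divide_eq)
    then have "c * \<omega> powr (p - 1) * \<omega> \<le> g \<omega> $ j * \<omega>"
      using w by (intro mult_right_mono) auto
    then show ?thesis
      using w by (simp add: powr_diff)
  qed
  \<comment> \<open>With \<open>K * c = 1\<close>, the convection term of the supersolution is at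
    least its reaction term.\<close>
  define K where "K = 1 / c"
  \<comment> \<open>\<open>K\<^sup>2\<close> pays for diffusion and \<open>K / m\<close> for the
    boundary flux, which is at most \<open>K\<close> relative to the supersolution.\<close>
  define B where "B = K\<^sup>2 + K / m + 1"
  have K: "K > 0" and B: "B > K\<^sup>2" "m * B > K" "B > 0"
    using c m by (auto simp: K_def B_def field_simps add_pos_pos)
  have comp: "compact (closure \<Omega>)"
    using dom by (simp add: compact_closure)
  obtain X where X: "\<And>x. x \<in> closure \<Omega> \<Longrightarrow> norm x \<le> X"
    using compact_imp_bounded[OF comp] unfolding bounded_iff by blast
  obtain M where M: "\<And>x. x \<in> closure \<Omega> \<Longrightarrow> \<bar>u0 x\<bar> \<le> M"
    using compact_imp_bounded[OF compact_continuous_image[OF assms(9) comp]] unfolding bounded_iff by auto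
  have X': "\<bar>x $ j\<bar> \<le> X" if "x \<in> closure \<Omega>" for x
    using X[OF that] component_le_norm_cart[of x j] by linarith
  \<comment> \<open>\<open>K * X\<close> offsets the most negative value of
    \<open>K * x $ j\<close>. Then \<open>v\<close> is at least \<open>W\<close>, where the growth
    bound on \<open>g\<close> starts, and at least \<open>M + 1\<close>, which is strictly above the
    initial data.\<close>
  define a where "a = ln (max W (M + 1)) + K * X"
  define v where "v = (\<lambda>(x::real^'n) t. exp (a + B * t + K * x $ j))"
  have v_ge: "max W (M + 1) \<le> v x t" if "x \<in> closure \<Omega>" "t \<ge> 0" for x t
  proof -
    have "K * X + K * x $ j \<ge> 0"
      using K X'[OF that(1)] by (simp flip: distrib_left)
    moreover have "B * t \<ge> 0"
      using B that by simp
    ultimately have "exp (ln (max W (M + 1))) \<le> v x t"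
      by (simp add: v_def a_def)
    then show ?thesis
      by (simp add: W_def max_def split: if_splits)
  qed
  obtain ut Du D2u where C21u: "C21_with_derivatives \<Omega> T u ut Du D2u"
    and pde: "\<And>x t. 0 < t \<Longrightarrow> ereal t < T \<Longrightarrow> x \<in> closure \<Omega> \<Longrightarrow>
       ut x t = trace (D2u x t) - g (u x t) \<bullet> Du x t + u x t powr p"
    and bdry: "\<And>x t. 0 < t \<Longrightarrow> ereal t < T \<Longrightarrow> x \<in> frontier \<Omega> \<Longrightarrow>
       \<sigma> x t * ut x t + Du x t \<bullet> outer_unit_normal \<Omega> x = 0"
    using sol unfolding classical_solution_def by blast
  note C21v = C21_with_derivatives_exp[of \<Omega> T a B K j, folded v_def]
  have u_less: "u x t < v x t" if "x \<in> closure \<Omega>" "0 \<le> t" "ereal t < T" for x t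
  proof (rule strict_comparison[OF assms(1) _ _ C21u _ _ _ _ _ _ _ that, where f = "\<lambda>w. w powr p"])
    show "C21_with_derivatives \<Omega> T v (\<lambda>x t. B * v x t) (\<lambda>x t. (K * v x t) *\<^sub>R axis j 1)
        (\<lambda>x t. (K\<^sup>2 * v x t) *\<^sub>R (\<chi> k l. if k = j \<and> l = j then 1 else 0))"
      using C21v by (simp add: v_def)
    show "continuous_on (closure \<Omega> \<times> {t. 0 \<le> t \<and> ereal t < T}) (\<lambda>(x, t). u x t)"
      using sol unfolding classical_solution_def by blast
    show "continuous_on (closure \<Omega> \<times> {t. 0 \<le> t \<and> ereal t < T}) (\<lambda>(x, t). v x t)"
      by (auto simp: v_def case_prod_beta intro!: continuous_intros)
    show "u x 0 < v x 0" if "x \<in> closure \<Omega>" for x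
      using sol v_ge[OF that order_refl] M[OF that] that unfolding classical_solution_def by fastforce
    show "trace ((K\<^sup>2 * v x t) *\<^sub>R (\<chi> k l. if k = j \<and> l = j then 1 else 0))
        - g (v x t) \<bullet> ((K * v x t) *\<^sub>R axis j 1) + v x t powr p < B * v x t"
      if x: "x \<in> \<Omega>" and t: "0 < t" for x t
    proof -
      have "v x t > 0"
        by (simp add: v_def)
      have "v x t \<ge> W"
        using v_ge[of x t] x t closure_subset[of \<Omega>] by auto
      then have "K * (c * v x t powr p) \<le> K * (g (v x t) $ j * v x t)"
        using W K by (intro mult_left_mono) auto
      then have "v x t powr p \<le> K * (g (v x t) $ j * v x t)"
        using c by (simp add: K_def)
      moreover have "K\<^sup>2 * v x t < B * v x t"
        using B \<open>v x t > 0\<close> by simp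
      moreover have "trace ((K\<^sup>2 * v x t) *\<^sub>R (\<chi> k l. if k = j \<and> l = j then 1 else 0) :: real^'n^'n)
          = K\<^sup>2 * v x t"
        by (simp add: trace_def if_distrib[of "\<lambda>x. _ * x"] cong: if_cong)
      ultimately show ?thesis
        by (simp add: inner_axis algebra_simps)
    qed
    show "0 < \<sigma> x t * (B * v x t) + ((K * v x t) *\<^sub>R axis j 1) \<bullet> outer_unit_normal \<Omega> x"
      if x: "x \<in> frontier \<Omega>" and t: "0 < t" "ereal t < T" for x t
    proof -
      \<comment> \<open>The normal derivative of \<open>v\<close> is \<open>K * v x t\<close> times
        component \<open>j\<close> of the unit normal, hence at least \<open>- K * v x t\<close>,
        and \<open>\<sigma> x t * B \<ge> m * B > K\<close> outweighs it.\<close>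
      have "\<bar>outer_unit_normal \<Omega> x $ j\<bar> \<le> 1"
        using component_le_norm_cart[of "outer_unit_normal \<Omega> x" j]
          outer_unit_normal_props(1)[OF assms(1) x] by simp
      then have "K * outer_unit_normal \<Omega> x $ j \<ge> K * - 1"
        using K by (intro mult_left_mono) auto
      moreover have "m * B \<le> \<sigma> x t * B"
        using m(2)[OF x t(1)] t R B by (intro mult_right_mono) auto
      ultimately have "0 < \<sigma> x t * B + K * outer_unit_normal \<Omega> x $ j"
        using B by linarith
      moreover have "v x t > 0"
        by (simp add: v_def)
      ultimately have "0 < (\<sigma> x t * B + K * outer_unit_normal \<Omega> x $ j) * v x t"
        by simp
      then show ?thesis
        by (simp add: inner_axis' algebra_simps)
    qed
  qed (use pde bdry assms(5) closure_subset[of \<Omega>] in \<open>auto\<close>)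
  define A where "A = exp (a + B * R + K * X)"
  have bound: "\<bar>u x t\<bar> \<le> A" if "x \<in> closure \<Omega>" "0 \<le> t" "t < R" for x t
  proof -
    have "0 \<le> u x t"
      using sol that R unfolding classical_solution_def by auto
    moreover have "v x t \<le> A"
      using that X'[OF that(1)] K B by (auto simp: v_def A_def intro!: add_mono mult_left_mono)
    ultimately show ?thesis
      using u_less[of x t] that R by auto
  qed
  let ?s = "{s. 0 < s \<and> ereal s \<le> T \<and> filterlim (\<lambda>t. SUP x\<in>closure \<Omega>. \<bar>u x t\<bar>) at_top (at_left s)}"
  \<comment> \<open>For an empty set of blow-up times the infimum would be infinite, whereas it
    equals the finite \<open>T\<close>.\<close>
  have "?s \<noteq> {}"
    using bT \<open>T \<noteq> \<infinity>\<close> unfolding blow_up_time_def by (metis image_empty Inf_empty top_ereal_def)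
  then obtain s where s: "0 < s" "s \<le> R"
    and lim: "filterlim (\<lambda>t. SUP x\<in>closure \<Omega>. \<bar>u x t\<bar>) at_top (at_left s)"
    using R by auto
  \<comment> \<open>Just before \<open>s \<le> R\<close> the supremum would exceed the uniform bound
    \<open>A\<close>; since the left filter at \<open>s\<close> is nontrivial, this is
    absurd.\<close>
  have "\<forall>\<^sub>F t in at_left s. A < (SUP x\<in>closure \<Omega>. \<bar>u x t\<bar>)"
    using lim by (simp add: filterlim_at_top_dense)
  moreover have "\<forall>\<^sub>F t in at_left s. 0 < t \<and> t < s"
    using s unfolding eventually_at_left_field by blast
  ultimately have "\<forall>\<^sub>F t in at_left s. False"
  proof eventually_elim
    case (elim t)
    have "(SUP x\<in>closure \<Omega>. \<bar>u x t\<bar>) \<le> A"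
      using dom elim s by (intro cSUP_least bound) auto
    with elim show False by simp
  qed
  then show False
    by simp
qed

end
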